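(* Let $(S,+)$ be a commutative semigroup and let $F=\{s_1,s_2,\ldots,s_l\}\subseteq S$ be a finite nonempty set of cardinality $l$. Let $HC_F=\{(a+n\cdot s_1,a+n\cdot s_2,\ldots,a+n\cdot s_l) : a\in S \text{ and } n\in\mathbb{N}\}$, which is a subsemigroup of $S^l$. Then for every piecewise syndetic subset $M\subseteq S$, the set $M^l\cap HC_F$ is piecewise syndetic in $HC_F$.
   Context: $\mathbb{N}$ denotes the set of positive integers. For a commutative semigroup $(T,+)$, $A\subseteq T$ and $t\in T$, put $-t+A=\{s\in T : t+s\in A\}$. A set $A\subseteq T$ is thick in $T$ if for every finite nonempty set $E\subseteq T$ there exists $x\in T$ such that $E+x\subseteq A$. A set $A\subseteq T$ is piecewise syndetic in $T$ if there exists a finite nonempty set $G\subseteq T$ such that $\bigcup_{t\in G}(-t+A)$ is thick in $T$. For $x\in S$ and $n\in\mathbb{N}$, $n\cdot x$ is the sum of $x$ with itself $n$ times. The product $S^l$ carries coordinatewise addition, and $HC_F$ is regarded as a commutative semigroup with the operation inherited from $S^l$; piecewise syndeticity in $HC_F$ is meant with respect to this semigroup. *)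

theory Defs
  imports "HOL-Analysis.Finite_Cartesian_Product"
begin

text \<open>
  The commutative semigroups are subsets \<open>T\<close> of a type of class \<open>ab_semigroup_add\<close>, with
  the inherited addition; the whole type is the case \<open>T = UNIV\<close>. Translates, thickness and
  piecewise syndeticity are all relative to \<open>T\<close>: every quantified element and finite set
  is taken from \<open>T\<close>.
\<close>

definition subsemigroup :: "'a::ab_semigroup_add set \<Rightarrow> bool" where
  "subsemigroup T \<longleftrightarrow> T \<noteq> {} \<and> (\<forall>x\<in>T. \<forall>y\<in>T. x + y \<in> T)"

definition neg_translate_in :: "'a::ab_semigroup_add set \<Rightarrow> 'a \<Rightarrow> 'a set \<Rightarrow> 'a set" where
  "neg_translate_in T t A = {s \<in> T. t + s \<in> A}"

definition thick_in :: "'a::ab_semigroup_add set \<Rightarrow> 'a set \<Rightarrow> bool" where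
  "thick_in T A \<longleftrightarrow> A \<subseteq> T \<and>
     (\<forall>E. finite E \<and> E \<noteq> {} \<and> E \<subseteq> T \<longrightarrow> (\<exists>x\<in>T. (\<lambda>e. e + x) ` E \<subseteq> A))"

definition piecewise_syndetic_in :: "'a::ab_semigroup_add set \<Rightarrow> 'a set \<Rightarrow> bool" where
  "piecewise_syndetic_in T A \<longleftrightarrow> A \<subseteq> T \<and>
     (\<exists>G. finite G \<and> G \<noteq> {} \<and> G \<subseteq> T \<and> thick_in T (\<Union>t\<in>G. neg_translate_in T t A))"

text \<open>
  A semigroup need not have a zero, so this is the \<open>n\<close>-fold sum \<open>x + \<dots> + x\<close> only for
  \<open>n \<ge> 1\<close> (the value at \<open>n = 0\<close> is \<open>x\<close> and carries no meaning).
\<close>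

definition nfold_sum :: "nat \<Rightarrow> 'a::ab_semigroup_add \<Rightarrow> 'a" where
  "nfold_sum n x = (((+) x) ^^ (n - 1)) x"

text \<open>
  The power \<open>S\<^sup>l\<close> is the vector type over a finite index type with \<open>l\<close> elements, with
  componentwise addition. The vector \<open>s\<close> lists the elements of \<open>F\<close>.
\<close>

definition HC :: "('a::ab_semigroup_add, 'l::finite) vec \<Rightarrow> ('a, 'l) vec set" where
  "HC s = {(\<chi> i. a + nfold_sum n (s $ i)) | a n. n \<ge> 1}"

definition cart_power :: "'a set \<Rightarrow> ('a, 'l::finite) vec set" where
  "cart_power M = {v. \<forall>i. v $ i \<in> M}"

end

theory Submission
  imports Defs "HOL-Library.Product_Plus"
begin

text \<open>
  The set \<open>HC s\<close> is the image of the ideal \<open>n \<ge> 1\<close> of the semigroup \<open>W = S \<times> \<nat>\<close> (with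
  \<open>\<nat>\<close> including 0) under \<open>(a, n) \<mapsto> (\<phi>\<^sub>i (a, n))\<^sub>i\<close>, where \<open>\<phi>\<^sub>i (a, n) = a + n \<cdot> s\<^sub>i\<close> and
  \<open>\<phi>\<^sub>i (a, 0) = a\<close>. Each \<open>\<phi>\<^sub>i : W \<rightarrow> S\<close> is a homomorphism, and all of them have the same
  homomorphic section \<open>\<delta> a = (a, 0)\<close>. The theorem therefore reduces to a statement about whole
  semigroups, \<open>piecewise_syndetic_simultaneous_preimage\<close>: for finitely many homomorphisms with a
  common section, the intersection of the preimages of a piecewise syndetic set is piecewise
  syndetic. The passage from \<open>W\<close> to the image of an ideal is
  \<open>piecewise_syndetic_ideal_image\<close>.

  The simultaneous statement is proved by the algebra of the space \<open>\<beta>S\<close> of ultrafilters. A set is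
  piecewise syndetic iff some translate \<open>-t + M\<close> of it belongs to an idempotent ultrafilter \<open>p\<close> in
  a minimal left ideal. Lift \<open>p\<close> to \<open>d = \<delta> p\<close>, and choose an idempotent \<open>r\<close> in a minimal left
  ideal \<open>R\<close> of \<open>\<beta>W\<close> inside \<open>\<beta>W + d\<close>. Then \<open>r + d = r\<close>, so \<open>q = d + r\<close> is an idempotent of
  \<open>R\<close> with \<open>d + q = q = q + d\<close>. Its image \<open>\<phi>\<^sub>i q\<close> is an idempotent below \<open>\<phi>\<^sub>i d = p\<close>, and a
  minimal idempotent has no idempotent below it but itself, so \<open>\<phi>\<^sub>i q = p\<close> for all \<open>i\<close> at once
  (\<open>lift_minimal_idempotent\<close>). Hence the intersection of the sets \<open>\<phi>\<^sub>i\<^sup>-\<^sup>1 (-t + M)\<close> belongs to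
  \<open>q\<close>, which lies in a minimal left ideal.

  The topology of \<open>\<beta>S\<close> is replaced by the lattice of filters. A filter stands for the closed set
  of the ultrafilters below it; \<open>top\<close> is the whole space, \<open>bot\<close> the empty set, and compactness
  becomes the fact that a chain of filters other than \<open>bot\<close> has an infimum other than \<open>bot\<close>.
  Closed left ideals are the filters \<open>L\<close> with \<open>top \<oplus> L \<le> L\<close>, that is, the translation-invariant
  ones.
\<close>

section \<open>Addition of filters\<close>

text \<open>
  On ultrafilters this is the extension of addition to \<open>\<beta>S\<close> that is continuous in the left
  argument. Defining it for all filters makes it associative and monotone without any appeal to
  maximality. For an ultrafilter \<open>u\<close>, \<open>F \<oplus> u\<close> represents the closed set of the sums \<open>v \<oplus> u\<close>
  with \<open>v \<le> F\<close>; for other right arguments it can be larger than the closure of the sums.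
\<close>

definition filter_add :: "'a::semigroup_add filter \<Rightarrow> 'a filter \<Rightarrow> 'a filter" (infixl "\<oplus>" 65)
  where "F \<oplus> G = Abs_filter (\<lambda>P. \<forall>\<^sub>F x in F. \<forall>\<^sub>F y in G. P (x + y))"

lemma eventually_filter_add:
  "eventually P (F \<oplus> G) \<longleftrightarrow> (\<forall>\<^sub>F x in F. \<forall>\<^sub>F y in G. P (x + y))"
  unfolding filter_add_def
proof (rule eventually_Abs_filter, rule is_filter.intro)
  fix P Q :: "'a \<Rightarrow> bool"
  assume "\<forall>\<^sub>F x in F. \<forall>\<^sub>F y in G. P (x + y)" "\<forall>\<^sub>F x in F. \<forall>\<^sub>F y in G. Q (x + y)"
  then show "\<forall>\<^sub>F x in F. \<forall>\<^sub>F y in G. P (x + y) \<and> Q (x + y)"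
    by eventually_elim (rule eventually_conj)
next
  fix P Q :: "'a \<Rightarrow> bool"
  assume "\<forall>x. P x \<longrightarrow> Q x" and "\<forall>\<^sub>F x in F. \<forall>\<^sub>F y in G. P (x + y)"
  then show "\<forall>\<^sub>F x in F. \<forall>\<^sub>F y in G. Q (x + y)"
    by (auto elim!: eventually_mono)
qed simp

lemma filter_add_assoc: "F \<oplus> G \<oplus> H = F \<oplus> (G \<oplus> H)"
  by (simp add: filter_eq_iff eventually_filter_add add.assoc)

lemma filter_add_mono: "F \<le> F' \<Longrightarrow> G \<le> G' \<Longrightarrow> F \<oplus> G \<le> F' \<oplus> G'"
  unfolding le_filter_def eventually_filter_add by (auto elim!: eventually_mono)

lemma filter_add_neq_bot: "F \<noteq> bot \<Longrightarrow> G \<noteq> bot \<Longrightarrow> F \<oplus> G \<noteq> bot"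
  by (auto simp: trivial_limit_def eventually_filter_add)

lemma top_filter_add_neq_bot: "F \<noteq> bot \<Longrightarrow> top \<oplus> F \<noteq> bot"
  by (rule filter_add_neq_bot) (simp_all add: trivial_limit_def eventually_top)

lemma filtermap_filter_add:
  assumes "\<And>x y. f (x + y) = f x + f y"
  shows "filtermap f (F \<oplus> G) = filtermap f F \<oplus> filtermap f G"
  by (simp add: filter_eq_iff eventually_filter_add eventually_filtermap assms)

lemma eventually_top_filter_add:
  "eventually P (top \<oplus> F) \<longleftrightarrow> (\<forall>x. \<forall>\<^sub>F y in F. P (x + y))"
  by (simp add: eventually_filter_add)

section \<open>Minimal filters and ultrafilters\<close>

text \<open>
  Zorn's lemma for filters, in a form that covers ultrafilters (\<open>f F = F\<close>), minimal closed
  subsemigroups (\<open>f F = F \<oplus> F\<close>) and minimal left ideals (\<open>f F = top \<oplus> F\<close>). Monotonicity of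
  \<open>f\<close> carries the condition \<open>f F \<le> F\<close> to infima; the infimum of a chain is not \<open>bot\<close> because it
  consists only of the sets in the members of the chain.
\<close>

lemma minimal_prefixed_filter:
  fixes f :: "'a filter \<Rightarrow> 'a filter"
  assumes mono: "\<And>F G. F \<le> G \<Longrightarrow> f F \<le> f G" and "F0 \<noteq> bot" "f F0 \<le> F0"
  obtains F where "F \<le> F0" "F \<noteq> bot" "f F \<le> F"
    "\<And>G. G \<le> F \<Longrightarrow> G \<noteq> bot \<Longrightarrow> f G \<le> G \<Longrightarrow> G = F"
proof -
  define A where "A = {F. F \<le> F0 \<and> F \<noteq> bot \<and> f F \<le> F}"
  have "\<exists>m\<in>A. \<forall>a\<in>A. a \<le> m \<longrightarrow> a = m"
  proof (rule predicate_Zorn)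
    show "partial_order_on A (relation_of (\<lambda>x y. y \<le> x) A)"
      by (auto simp: partial_order_on_def preorder_on_def refl_on_def trans_def antisym_def
          relation_of_def)
  next
    fix C assume C: "C \<in> Chains (relation_of (\<lambda>x y. y \<le> x) A)"
    then have CA: "C \<subseteq> A" and total: "\<And>x y. x \<in> C \<Longrightarrow> y \<in> C \<Longrightarrow> x \<le> y \<or> y \<le> x"
      by (auto simp: Chains_def relation_of_def)
    show "\<exists>u\<in>A. \<forall>a\<in>C. u \<le> a"
    proof (cases "C = {}")
      case True
      then show ?thesis using assms by (auto simp: A_def)
    next
      case False
      have base: "eventually P (Inf C) \<longleftrightarrow> (\<exists>b\<in>C. eventually P b)" for P
      proof (rule eventually_Inf_base[OF False])
        fix F G assume "F \<in> C" "G \<in> C"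
        then show "\<exists>x\<in>C. x \<le> inf F G" using total[of F G] by auto
      qed
      have "Inf C \<noteq> bot"
        using CA by (auto simp: trivial_limit_def base A_def)
      moreover have "f (Inf C) \<le> Inf C"
      proof (rule Inf_greatest)
        fix F assume "F \<in> C"
        then have "f (Inf C) \<le> f F" "f F \<le> F"
          using CA by (auto simp: A_def intro: mono Inf_lower)
        then show "f (Inf C) \<le> F" by (rule order_trans)
      qed
      moreover have "Inf C \<le> F0"
        using False CA by (auto simp: A_def intro: Inf_lower2)
      ultimately show ?thesis by (auto simp: A_def intro: Inf_lower)
    qed
  qed
  then obtain m where "m \<in> A" "\<And>a. a \<in> A \<Longrightarrow> a \<le> m \<Longrightarrow> a = m" by blast
  then show ?thesis
    by (intro that[of m]) (auto simp: A_def)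
qed

definition ultrafilter :: "'a filter \<Rightarrow> bool" where
  "ultrafilter U \<longleftrightarrow> U \<noteq> bot \<and> (\<forall>P. eventually P U \<or> (\<forall>\<^sub>F x in U. \<not> P x))"

lemma ultrafilter_minimal:
  assumes "ultrafilter U" "G \<le> U" "G \<noteq> bot"
  shows "G = U"
proof (rule antisym[OF assms(2)], rule filter_leI)
  fix P assume P: "eventually P G"
  show "eventually P U"
  proof (rule ccontr)
    assume "\<not> eventually P U"
    then have "\<forall>\<^sub>F x in G. \<not> P x" using assms by (auto simp: ultrafilter_def le_filter_def)
    with P have "\<forall>\<^sub>F x in G. False" by eventually_elim simp
    with \<open>G \<noteq> bot\<close> show False by (simp add: trivial_limit_def)
  qed
qed

lemma ultrafilter_exists:
  assumes "F \<noteq> bot"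
  obtains U where "U \<le> F" "ultrafilter U"
proof -
  obtain U where U: "U \<le> F" "U \<noteq> bot" "\<And>G. G \<le> U \<Longrightarrow> G \<noteq> bot \<Longrightarrow> G = U"
    using minimal_prefixed_filter[of "\<lambda>F. F" F] assms by auto
  have "eventually P U \<or> (\<forall>\<^sub>F x in U. \<not> P x)" for P
  proof (cases "inf U (principal {x. P x}) = bot")
    case True
    then show ?thesis by (simp add: trivial_limit_def eventually_inf_principal)
  next
    case False
    with U(3)[of "inf U (principal {x. P x})"] have "inf U (principal {x. P x}) = U" by simp
    then have "U \<le> principal {x. P x}" by (metis inf_le2)
    then show ?thesis by (simp add: le_principal)
  qed
  with U that show ?thesis by (auto simp: ultrafilter_def)
qed

section \<open>Idempotents and minimal left ideals\<close>

text \<open>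
  The preimage of a closed set \<open>N\<close> under right addition of \<open>u\<close>, cut down to \<open>F\<close>. It is generated
  by \<open>F\<close> and the sets \<open>{x. \<forall>\<^sub>F y in u. P (x + y)}\<close> for \<open>P\<close> in \<open>N\<close>, and it is not empty because
  \<open>N\<close> lies in the image \<open>F \<oplus> u\<close>.
\<close>

lemma left_factor:
  assumes u: "ultrafilter u" and N: "N \<noteq> bot" "N \<le> F \<oplus> u"
  obtains v where "v \<le> F" "v \<noteq> bot" "v \<oplus> u \<le> N"
    "\<And>w. w \<le> F \<Longrightarrow> w \<oplus> u \<le> N \<Longrightarrow> w \<le> v"
proof -
  define R where "R Q \<longleftrightarrow>
    (\<exists>P. eventually P N \<and> (\<forall>\<^sub>F x in F. (\<forall>\<^sub>F y in u. P (x + y)) \<longrightarrow> Q x))" for Q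
  have "is_filter R"
  proof
    show "R (\<lambda>x. True)" unfolding R_def by (intro exI[of _ "\<lambda>x. True"]) simp
  next
    fix Q1 Q2 assume "R Q1" "R Q2"
    then obtain P1 P2 where P: "eventually P1 N" "eventually P2 N"
      and 1: "\<forall>\<^sub>F x in F. (\<forall>\<^sub>F y in u. P1 (x + y)) \<longrightarrow> Q1 x"
      and 2: "\<forall>\<^sub>F x in F. (\<forall>\<^sub>F y in u. P2 (x + y)) \<longrightarrow> Q2 x"
      unfolding R_def by auto
    have "eventually (\<lambda>x. P1 x \<and> P2 x) N" using P by (rule eventually_conj)
    moreover have "\<forall>\<^sub>F x in F. (\<forall>\<^sub>F y in u. P1 (x + y) \<and> P2 (x + y)) \<longrightarrow> Q1 x \<and> Q2 x"
      using 1 2 by eventually_elim (auto simp: eventually_conj_iff)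
    ultimately show "R (\<lambda>x. Q1 x \<and> Q2 x)" unfolding R_def by (intro exI conjI)
  next
    fix Q1 Q2 :: "'a \<Rightarrow> bool" assume "\<forall>x. Q1 x \<longrightarrow> Q2 x" "R Q1"
    then show "R Q2" unfolding R_def by (auto elim!: eventually_mono)
  qed
  define v where "v = Abs_filter R"
  have ev: "eventually Q v \<longleftrightarrow> R Q" for Q
    unfolding v_def by (rule eventually_Abs_filter[OF \<open>is_filter R\<close>])
  show ?thesis
  proof
    show "v \<le> F"
    proof (rule filter_leI)
      fix Q assume "eventually Q F"
      then show "eventually Q v" unfolding ev R_def
        by (intro exI[of _ "\<lambda>x. True"]) (auto elim: eventually_mono)
    qed
    show "v \<noteq> bot"
    proof
      assume "v = bot"
      then have "R (\<lambda>x. False)" by (simp add: ev[symmetric])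
      then obtain P where P: "eventually P N" "\<forall>\<^sub>F x in F. \<not> (\<forall>\<^sub>F y in u. P (x + y))"
        unfolding R_def by auto
      \<comment> \<open>only for an ultrafilter does the failure of a property make its negation hold
          eventually\<close>
      from P(2) have "\<forall>\<^sub>F x in F. \<forall>\<^sub>F y in u. \<not> P (x + y)"
        by (rule eventually_mono) (use u in \<open>auto simp: ultrafilter_def\<close>)
      then have "\<forall>\<^sub>F x in F \<oplus> u. \<not> P x" by (simp add: eventually_filter_add)
      then have "\<forall>\<^sub>F x in N. \<not> P x" using N(2) by (simp add: le_filter_def)
      with P(1) have "\<forall>\<^sub>F x in N. False" by eventually_elim simp
      with N(1) show False by (simp add: trivial_limit_def)
    qed
    show "v \<oplus> u \<le> N"
    proof (rule filter_leI)
      fix P assume "eventually P N"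
      then show "eventually P (v \<oplus> u)" unfolding eventually_filter_add ev R_def
        by (intro exI[of _ P]) simp
    qed
    show "w \<le> v" if w: "w \<le> F" "w \<oplus> u \<le> N" for w
    proof (rule filter_leI)
      fix Q assume "eventually Q v"
      then obtain P where P: "eventually P N"
        and 1: "\<forall>\<^sub>F x in F. (\<forall>\<^sub>F y in u. P (x + y)) \<longrightarrow> Q x"
        unfolding ev R_def by auto
      have "\<forall>\<^sub>F x in w. (\<forall>\<^sub>F y in u. P (x + y)) \<longrightarrow> Q x" using 1 w(1) by (simp add: le_filter_def)
      moreover have "\<forall>\<^sub>F x in w. \<forall>\<^sub>F y in u. P (x + y)"
        using P w(2) by (simp add: le_filter_def eventually_filter_add)
      ultimately show "eventually Q w" by eventually_elim simp
    qed
  qed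
qed

text \<open>
  The Ellis--Numakura lemma. A minimal closed subsemigroup \<open>p\<close> is a single point: for \<open>u\<close> in it,
  \<open>p \<oplus> u\<close> is a closed subsemigroup of \<open>p\<close>, hence equal to \<open>p\<close>; then the solutions \<open>v \<le> p\<close> of
  \<open>v \<oplus> u = u\<close> form a nonempty closed subsemigroup, hence exhaust \<open>p\<close>, so that
  \<open>p = p \<oplus> u = u\<close>.
\<close>

lemma idempotent_ultrafilter_exists:
  assumes "F \<noteq> bot" "F \<oplus> F \<le> F"
  obtains p where "p \<le> F" "ultrafilter p" "p \<oplus> p = p"
proof -
  obtain p where p: "p \<le> F" "p \<noteq> bot" "p \<oplus> p \<le> p"
    and min: "\<And>G. G \<le> p \<Longrightarrow> G \<noteq> bot \<Longrightarrow> G \<oplus> G \<le> G \<Longrightarrow> G = p"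
    using minimal_prefixed_filter[of "\<lambda>F. F \<oplus> F" F] assms filter_add_mono by metis
  obtain u where u: "u \<le> p" "ultrafilter u" using ultrafilter_exists[OF p(2)] .
  have ubot: "u \<noteq> bot" using u by (simp add: ultrafilter_def)
  have pu: "p \<oplus> u = p"
  proof (rule min)
    show "p \<oplus> u \<le> p" using filter_add_mono[OF order_refl u(1), of p] p(3) by (rule order_trans)
    have "p \<oplus> u \<oplus> (p \<oplus> u) \<le> p \<oplus> p \<oplus> (p \<oplus> u)"
      using u(1) by (intro filter_add_mono) auto
    also have "\<dots> \<le> p \<oplus> (p \<oplus> u)"
      using p(3) by (intro filter_add_mono) auto
    also have "\<dots> = p \<oplus> p \<oplus> u" by (rule filter_add_assoc[symmetric])
    also have "\<dots> \<le> p \<oplus> u"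
      using p(3) by (intro filter_add_mono) auto
    finally show "p \<oplus> u \<oplus> (p \<oplus> u) \<le> p \<oplus> u" .
  qed (rule filter_add_neq_bot[OF p(2) ubot])
  obtain v where v: "v \<le> p" "v \<noteq> bot" "v \<oplus> u \<le> u"
    and largest: "\<And>w. w \<le> p \<Longrightarrow> w \<oplus> u \<le> u \<Longrightarrow> w \<le> v"
    using left_factor[OF u(2) ubot, of p] u(1) pu by metis
  have "v \<oplus> v \<le> v"
  proof (rule largest)
    show "v \<oplus> v \<le> p" using filter_add_mono[OF v(1) v(1)] p(3) by (rule order_trans)
    have "v \<oplus> v \<oplus> u = v \<oplus> (v \<oplus> u)" by (rule filter_add_assoc)
    also have "\<dots> \<le> v \<oplus> u" using v(3) by (intro filter_add_mono) auto
    also have "\<dots> \<le> u" by (rule v(3))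
    finally show "v \<oplus> v \<oplus> u \<le> u" .
  qed
  then have "v = p" using min v by blast
  with v(3) pu have "p \<le> u" by simp
  with u(1) have pu_eq: "p = u" by simp
  then have "p \<oplus> p = p" using pu by simp
  then show ?thesis using that p(1) u(2) pu_eq by simp
qed

definition minimal_left_ideal :: "'a::semigroup_add filter \<Rightarrow> bool" where
  "minimal_left_ideal L \<longleftrightarrow> L \<noteq> bot \<and> top \<oplus> L \<le> L \<and>
     (\<forall>G. G \<le> L \<longrightarrow> G \<noteq> bot \<longrightarrow> top \<oplus> G \<le> G \<longrightarrow> G = L)"

lemma top_top_filter_add_le: "top \<oplus> (top \<oplus> F) \<le> top \<oplus> F"
  by (subst filter_add_assoc[symmetric], rule filter_add_mono) auto

lemma minimal_left_ideal_exists: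
  assumes "F \<noteq> bot" "top \<oplus> F \<le> F"
  obtains L where "L \<le> F" "minimal_left_ideal L"
proof -
  obtain L where "L \<le> F" "L \<noteq> bot" "top \<oplus> L \<le> L"
    "\<And>G. G \<le> L \<Longrightarrow> G \<noteq> bot \<Longrightarrow> top \<oplus> G \<le> G \<Longrightarrow> G = L"
    using minimal_prefixed_filter[of "\<lambda>F. top \<oplus> F" F] assms filter_add_mono[OF order_refl]
    by metis
  then show ?thesis by (intro that) (auto simp: minimal_left_ideal_def)
qed

lemma minimal_left_ideal_generated:
  assumes "minimal_left_ideal L" "F \<le> L" "F \<noteq> bot"
  shows "top \<oplus> F = L"
proof -
  have "top \<oplus> F \<le> top \<oplus> L" using assms(2) by (intro filter_add_mono) auto
  also have "\<dots> \<le> L" using assms(1) by (simp add: minimal_left_ideal_def)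
  finally have "top \<oplus> F \<le> L" .
  moreover have "top \<oplus> F \<noteq> bot" using assms(3) by (rule top_filter_add_neq_bot)
  ultimately show ?thesis
    using assms(1) top_top_filter_add_le[of F] unfolding minimal_left_ideal_def by blast
qed

lemma minimal_left_ideal_idempotent:
  assumes "minimal_left_ideal L"
  obtains p where "p \<le> L" "ultrafilter p" "p \<oplus> p = p"
proof (rule idempotent_ultrafilter_exists)
  show "L \<noteq> bot" using assms by (simp add: minimal_left_ideal_def)
  have "L \<oplus> L \<le> top \<oplus> L" by (rule filter_add_mono) auto
  also have "\<dots> \<le> L" using assms by (simp add: minimal_left_ideal_def)
  finally show "L \<oplus> L \<le> L" .
qed (rule that)

text \<open>
  An element of the left ideal generated by an idempotent \<open>p\<close> has the form \<open>v \<oplus> p\<close>, so \<open>p\<close> acts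
  on it as a right identity.
\<close>

lemma idempotent_right_identity:
  assumes p: "ultrafilter p" "p \<oplus> p = p" and N: "ultrafilter N" "N \<le> F \<oplus> p"
  shows "N \<oplus> p = N"
proof -
  obtain v where v: "v \<noteq> bot" "v \<oplus> p \<le> N"
  proof (rule left_factor[OF p(1) _ N(2)])
    show "N \<noteq> bot" using N(1) by (simp add: ultrafilter_def)
  qed
  have "p \<noteq> bot" using p(1) by (simp add: ultrafilter_def)
  then have "v \<oplus> p = N" using ultrafilter_minimal[OF N(1) v(2)] filter_add_neq_bot[OF v(1)] by blast
  then show ?thesis using p(2) by (metis filter_add_assoc)
qed

lemma ultrafilter_filtermap: "ultrafilter U \<Longrightarrow> ultrafilter (filtermap f U)"
  by (auto simp: ultrafilter_def filtermap_bot_iff eventually_filtermap)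

text \<open>
  Minimal idempotents have nothing below them: \<open>q = q \<oplus> p\<close> lies in the minimal left ideal \<open>L\<close>,
  which \<open>q\<close> then generates as well; so \<open>q\<close> is a right identity for \<open>p\<close>, and \<open>p = p \<oplus> q = q\<close>.
\<close>

lemma minimal_idempotent_eq:
  assumes L: "minimal_left_ideal L" and p: "p \<le> L" "ultrafilter p" "p \<oplus> p = p"
    and q: "ultrafilter q" "q \<oplus> q = q" "p \<oplus> q = q" "q \<oplus> p = q"
  shows "q = p"
proof -
  have qbot: "q \<noteq> bot" using q by (simp add: ultrafilter_def)
  have "q \<le> top \<oplus> p" using filter_add_mono[of q top p p] q(4) by simp
  also have "\<dots> \<le> top \<oplus> L" using p(1) by (intro filter_add_mono) auto
  also have "\<dots> \<le> L" using L by (simp add: minimal_left_ideal_def)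
  finally have "top \<oplus> q = L" using L qbot by (intro minimal_left_ideal_generated)
  then have "p \<oplus> q = p" using idempotent_right_identity[OF q(1,2) p(2), of top] p(1) by simp
  with q(3) show ?thesis by simp
qed

lemma ultrafilter_filter_add:
  assumes "ultrafilter p" "ultrafilter q"
  shows "ultrafilter (p \<oplus> q)"
  unfolding ultrafilter_def
proof (intro conjI allI)
  show "p \<oplus> q \<noteq> bot" using assms by (intro filter_add_neq_bot) (simp_all add: ultrafilter_def)
  fix P
  show "eventually P (p \<oplus> q) \<or> (\<forall>\<^sub>F x in p \<oplus> q. \<not> P x)"
  proof (cases "\<forall>\<^sub>F x in p. \<forall>\<^sub>F y in q. P (x + y)")
    case False
    then have "\<forall>\<^sub>F x in p. \<not> (\<forall>\<^sub>F y in q. P (x + y))" using assms(1) by (auto simp: ultrafilter_def)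
    then have "\<forall>\<^sub>F x in p. \<forall>\<^sub>F y in q. \<not> P (x + y)"
      by (rule eventually_mono) (use assms(2) in \<open>auto simp: ultrafilter_def\<close>)
    then show ?thesis by (simp add: eventually_filter_add)
  qed (simp add: eventually_filter_add)
qed

text \<open>
  The heart of the proof. In \<open>R\<close> alone one finds, for each \<open>i\<close> separately, an ultrafilter that
  \<open>\<phi> i\<close> maps to \<open>p\<close>; one ultrafilter that serves all \<open>i\<close> exists because idempotents below a
  minimal idempotent are unique: \<open>q\<close> is built from \<open>\<delta>\<close> and \<open>p\<close> without reference to any \<open>\<phi> i\<close>,
  and its image is forced to be \<open>p\<close>.
\<close>

lemma lift_minimal_idempotent:
  fixes \<delta> :: "'a::semigroup_add \<Rightarrow> 'b::semigroup_add" and \<phi> :: "'i \<Rightarrow> 'b \<Rightarrow> 'a"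
  assumes \<delta>: "\<And>x y. \<delta> (x + y) = \<delta> x + \<delta> y"
    and \<phi>: "\<And>i x y. \<phi> i (x + y) = \<phi> i x + \<phi> i y"
    and retraction: "\<And>i x. \<phi> i (\<delta> x) = x"
    and L: "minimal_left_ideal L" and p: "p \<le> L" "ultrafilter p" "p \<oplus> p = p"
  obtains R q where "minimal_left_ideal R" "ultrafilter q" "q \<le> R" "\<And>i. filtermap (\<phi> i) q = p"
proof -
  define d where "d = filtermap \<delta> p"
  have d: "ultrafilter d" "d \<oplus> d = d"
    unfolding d_def using p(2,3) filtermap_filter_add[OF \<delta>, of p p]
    by (auto intro: ultrafilter_filtermap)
  have \<phi>d: "filtermap (\<phi> i) d = p" for i
    by (simp add: d_def filtermap_filtermap retraction)
  have "top \<oplus> d \<noteq> bot" using d by (simp add: top_filter_add_neq_bot ultrafilter_def)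
  then obtain R where R: "R \<le> top \<oplus> d" "minimal_left_ideal R"
    using minimal_left_ideal_exists top_top_filter_add_le by blast
  obtain r where r: "r \<le> R" "ultrafilter r" "r \<oplus> r = r"
    using minimal_left_ideal_idempotent[OF R(2)] .
  have rd: "r \<oplus> d = r"
    using idempotent_right_identity[OF d r(2), of top] r(1) R(1) by (meson order_trans)
  define q where "q = d \<oplus> r"
  have q: "ultrafilter q" unfolding q_def using d(1) r(2) by (rule ultrafilter_filter_add)
  have qq: "q \<oplus> q = q" "d \<oplus> q = q" "q \<oplus> d = q"
    unfolding q_def by (metis filter_add_assoc rd r(3) d(2))+
  have "q \<le> top \<oplus> R" unfolding q_def using r(1) by (intro filter_add_mono) auto
  also have "\<dots> \<le> R" using R(2) by (simp add: minimal_left_ideal_def)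
  finally have "q \<le> R" .
  moreover have "filtermap (\<phi> i) q = p" for i
  proof (rule minimal_idempotent_eq[OF L p])
    show "ultrafilter (filtermap (\<phi> i) q)" using q by (rule ultrafilter_filtermap)
    show "filtermap (\<phi> i) q \<oplus> filtermap (\<phi> i) q = filtermap (\<phi> i) q"
      using filtermap_filter_add[of "\<phi> i" q q, OF \<phi>] qq(1) by simp
    show "p \<oplus> filtermap (\<phi> i) q = filtermap (\<phi> i) q"
      using filtermap_filter_add[of "\<phi> i" d q, OF \<phi>] qq(2) \<phi>d by simp
    show "filtermap (\<phi> i) q \<oplus> p = filtermap (\<phi> i) q"
      using filtermap_filter_add[of "\<phi> i" q d, OF \<phi>] qq(3) \<phi>d by simp
  qed
  ultimately show ?thesis using that R(2) q by blast
qed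

section \<open>Piecewise syndetic sets\<close>

text \<open>
  If no finite union of translates of \<open>B\<close> belonged to \<open>R\<close>, then \<open>R\<close> and the complements of all
  translates would generate a nonempty closed set \<open>N\<close> inside \<open>R\<close>. It would generate \<open>R\<close> as a left
  ideal, and so every member of \<open>R\<close>, in particular \<open>q\<close>, would avoid \<open>B\<close>. A set in the
  translation-invariant filter \<open>R\<close> is thick.
\<close>

lemma piecewise_syndetic_if_minimal:
  fixes B :: "'a::ab_semigroup_add set"
  assumes R: "minimal_left_ideal R" and q: "ultrafilter q" "q \<le> R" "\<forall>\<^sub>F x in q. x \<in> B"
  shows "piecewise_syndetic_in UNIV B"
proof -
  define N where "N = inf R (INF g\<in>UNIV. principal {x. g + x \<notin> B})"
  have "N = bot"
  proof (rule ccontr)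
    assume "N \<noteq> bot"
    moreover have "N \<le> R" by (simp add: N_def)
    ultimately have N: "top \<oplus> N = R" using minimal_left_ideal_generated[OF R] by blast
    have "\<forall>\<^sub>F x in N. g + x \<notin> B" for g
    proof -
      have "N \<le> principal {x. g + x \<notin> B}"
        unfolding N_def by (meson INF_lower UNIV_I inf.coboundedI2)
      then show ?thesis by (simp add: le_principal)
    qed
    then have "\<forall>\<^sub>F x in R. x \<notin> B"
      unfolding N[symmetric] by (simp add: eventually_top_filter_add)
    then have "\<forall>\<^sub>F x in q. x \<notin> B" using q(2) by (simp add: le_filter_def)
    with q(3) have "\<forall>\<^sub>F x in q. False" by eventually_elim simp
    then show False using q(1) by (simp add: ultrafilter_def trivial_limit_def)
  qed
  then have "\<forall>\<^sub>F x in N. False" by simp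
  then obtain P Q where P: "eventually P R" and Q: "\<And>x. \<not> (P x \<and> Q x)"
    and evQ: "eventually Q (INF g\<in>UNIV. principal {x. g + x \<notin> B})"
    unfolding N_def eventually_inf by blast
  obtain G where G: "finite G" "eventually Q (INF g\<in>G. principal {x. g + x \<notin> B})"
    using evQ unfolding eventually_INF[of _ _ UNIV] by blast
  then have GQ: "(\<And>g. g \<in> G \<Longrightarrow> g + x \<notin> B) \<Longrightarrow> Q x" for x
    by (auto simp: eventually_INF_finite eventually_principal)
  have ev: "\<forall>\<^sub>F x in R. \<exists>g\<in>G. g + x \<in> B"
    using P by (rule eventually_mono) (use Q GQ in blast)
  have Rbot: "R \<noteq> bot" and left: "top \<oplus> R \<le> R" using R by (auto simp: minimal_left_ideal_def)
  have "G \<noteq> {}" using ev Rbot by (auto simp: trivial_limit_def)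
  moreover have "thick_in UNIV (\<Union>t\<in>G. neg_translate_in UNIV t B)"
    unfolding thick_in_def
  proof (intro conjI allI impI)
    fix E :: "'a set" assume E: "finite E \<and> E \<noteq> {} \<and> E \<subseteq> UNIV"
    have "\<forall>e. \<forall>\<^sub>F x in R. \<exists>g\<in>G. g + (e + x) \<in> B"
      using filter_leD[OF left ev] by (simp add: eventually_top_filter_add)
    then have "\<forall>\<^sub>F x in R. \<forall>e\<in>E. \<exists>g\<in>G. g + (e + x) \<in> B"
      using E by (intro eventually_ball_finite) auto
    then obtain x where "\<forall>e\<in>E. \<exists>g\<in>G. g + (e + x) \<in> B"
      using eventually_happens'[OF Rbot] by blast
    then show "\<exists>x\<in>UNIV. (\<lambda>e. e + x) ` E \<subseteq> (\<Union>t\<in>G. neg_translate_in UNIV t B)"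
      by (intro bexI[of _ x]) (auto simp: neg_translate_in_def)
  qed simp
  ultimately show ?thesis
    unfolding piecewise_syndetic_in_def using G(1) by blast
qed

text \<open>
  The translates of a thick set \<open>C\<close> have the finite intersection property and generate a
  translation-invariant filter. Any idempotent \<open>p\<close> of a minimal left ideal below it contains a
  translate of \<open>C\<close>; as \<open>C\<close> is a finite union of translates of \<open>M\<close>, \<open>p\<close> contains one of these.
\<close>

lemma minimal_idempotent_if_piecewise_syndetic:
  fixes M :: "'a::ab_semigroup_add set"
  assumes "piecewise_syndetic_in UNIV M"
  obtains L p t where "minimal_left_ideal L" "p \<le> L" "ultrafilter p" "p \<oplus> p = p"
    "\<forall>\<^sub>F x in p. t + x \<in> M"
proof -
  obtain G where G: "finite G" "G \<noteq> {}"
    and thick: "thick_in UNIV (\<Union>t\<in>G. neg_translate_in UNIV t M)"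
    using assms by (auto simp: piecewise_syndetic_in_def)
  define C where "C = (\<Union>t\<in>G. neg_translate_in UNIV t M)"
  define F where "F = (INF e\<in>UNIV. principal {x. e + x \<in> C})"
  have F_e: "\<forall>\<^sub>F x in F. e + x \<in> C" for e
  proof -
    have "F \<le> principal {x. e + x \<in> C}" unfolding F_def by (rule INF_lower) simp
    then show ?thesis by (simp add: le_principal)
  qed
  have "F \<noteq> bot"
  proof
    assume "F = bot"
    then have "\<forall>\<^sub>F x in F. False" by simp
    then obtain E where E: "finite E" "\<forall>\<^sub>F x in (INF e\<in>E. principal {x. e + x \<in> C}). False"
      unfolding F_def eventually_INF[of _ _ UNIV] by blast
    then have none: "\<exists>e\<in>E. e + x \<notin> C" for x
      by (simp add: eventually_INF_finite eventually_principal) metis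
    then have "E \<noteq> {}" by auto
    with E(1) thick have "\<exists>x\<in>UNIV. (\<lambda>e. e + x) ` E \<subseteq> C"
      unfolding thick_in_def C_def by blast
    then obtain x where "(\<lambda>e. e + x) ` E \<subseteq> C" by blast
    with none[of x] show False by auto
  qed
  moreover have "top \<oplus> F \<le> F"
  proof -
    have "top \<oplus> F \<le> principal {x. e + x \<in> C}" for e
      unfolding le_principal eventually_top_filter_add using F_e[of "e + _"] by (simp add: add.assoc)
    then show ?thesis by (subst (2) F_def) (rule INF_greatest)
  qed
  ultimately obtain L where L: "L \<le> F" "minimal_left_ideal L"
    using minimal_left_ideal_exists by blast
  obtain p where p: "p \<le> L" "ultrafilter p" "p \<oplus> p = p"
    using minimal_left_ideal_idempotent[OF L(2)] .
  \<comment> \<open>The semigroup may lack a zero, so \<open>F\<close> need not contain \<open>C\<close> itself; any translate of it serves.\<close>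
  obtain e :: 'a where True by simp
  have "\<forall>\<^sub>F x in p. e + x \<in> C"
    using F_e[of e] L(1) p(1) by (meson filter_leD)
  then have ex: "\<forall>\<^sub>F x in p. \<exists>t\<in>G. t + (e + x) \<in> M"
    by (rule eventually_mono) (auto simp: C_def neg_translate_in_def)
  have "\<exists>t\<in>G. \<forall>\<^sub>F x in p. t + (e + x) \<in> M"
  proof (rule ccontr)
    assume "\<not> ?thesis"
    then have "\<forall>t\<in>G. \<forall>\<^sub>F x in p. t + (e + x) \<notin> M" using p(2) by (auto simp: ultrafilter_def)
    then have "\<forall>\<^sub>F x in p. \<forall>t\<in>G. t + (e + x) \<notin> M" using G(1) by (rule eventually_ball_finite[rotated])
    with ex have "\<forall>\<^sub>F x in p. False" by eventually_elim blast
    then show False using p(2) by (simp add: ultrafilter_def trivial_limit_def)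
  qed
  then obtain t where "\<forall>\<^sub>F x in p. (t + e) + x \<in> M" by (auto simp: add.assoc)
  then show ?thesis using that L(2) p by blast
qed

lemma piecewise_syndetic_translate:
  assumes "piecewise_syndetic_in UNIV {x. t + x \<in> B}"
  shows "piecewise_syndetic_in UNIV B"
proof -
  obtain G where G: "finite G" "G \<noteq> {}"
    and thick: "thick_in UNIV (\<Union>g\<in>G. neg_translate_in UNIV g {x. t + x \<in> B})"
    using assms by (auto simp: piecewise_syndetic_in_def)
  have "(\<Union>g\<in>G. neg_translate_in UNIV g {x. t + x \<in> B}) =
      (\<Union>g\<in>(+) t ` G. neg_translate_in UNIV g B)"
    by (auto simp: neg_translate_in_def add.assoc)
  with G thick show ?thesis
    unfolding piecewise_syndetic_in_def by (intro conjI exI[of _ "(+) t ` G"]) auto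
qed

text \<open>
  The set \<open>{w. \<forall>i. t + \<phi> i w \<in> M}\<close> belongs to a member of a minimal left ideal. The common section
  turns the translation by \<open>t\<close> in every coordinate into the single translation by \<open>\<delta> t\<close>.
\<close>

lemma piecewise_syndetic_simultaneous_preimage:
  fixes \<delta> :: "'a::ab_semigroup_add \<Rightarrow> 'b::ab_semigroup_add" and \<phi> :: "'i::finite \<Rightarrow> 'b \<Rightarrow> 'a"
  assumes \<delta>: "\<And>x y. \<delta> (x + y) = \<delta> x + \<delta> y"
    and \<phi>: "\<And>i x y. \<phi> i (x + y) = \<phi> i x + \<phi> i y"
    and retraction: "\<And>i x. \<phi> i (\<delta> x) = x"
    and M: "piecewise_syndetic_in UNIV M"
  shows "piecewise_syndetic_in UNIV {w. \<forall>i. \<phi> i w \<in> M}"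
proof -
  obtain L p t where L: "minimal_left_ideal L" and p: "p \<le> L" "ultrafilter p" "p \<oplus> p = p"
    and t: "\<forall>\<^sub>F x in p. t + x \<in> M"
    using minimal_idempotent_if_piecewise_syndetic[OF M] .
  obtain R q where R: "minimal_left_ideal R" and q: "ultrafilter q" "q \<le> R"
    and \<phi>q: "\<And>i. filtermap (\<phi> i) q = p"
    using lift_minimal_idempotent[of \<delta> \<phi>, OF \<delta> \<phi> retraction L p] by blast
  have "\<forall>\<^sub>F w in q. t + \<phi> i w \<in> M" for i
    using t unfolding \<phi>q[of i, symmetric] by (simp add: eventually_filtermap)
  then have "\<forall>\<^sub>F w in q. \<forall>i. t + \<phi> i w \<in> M" by (simp add: eventually_all_finite)
  then have "\<forall>\<^sub>F w in q. w \<in> {w. \<delta> t + w \<in> {w. \<forall>i. \<phi> i w \<in> M}}"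
    by (simp add: \<phi> retraction)
  then have "piecewise_syndetic_in UNIV {w. \<delta> t + w \<in> {w. \<forall>i. \<phi> i w \<in> M}}"
    by (intro piecewise_syndetic_if_minimal[OF R q]) simp
  then show ?thesis by (rule piecewise_syndetic_translate)
qed

text \<open>
  An element \<open>z\<close> of the ideal \<open>I\<close> pushes witnesses into \<open>I\<close>. Thickness is applied to
  \<open>z + z + E'\<close> rather than to \<open>E'\<close>, so that one \<open>z\<close> can be moved to the translating element \<open>g\<close>
  and the other to the shift \<open>x\<close>; both must lie in the image of \<open>I\<close>.
\<close>

lemma piecewise_syndetic_ideal_image:
  fixes \<psi> :: "'b::ab_semigroup_add \<Rightarrow> 'c::ab_semigroup_add"
  assumes \<psi>: "\<And>x y. \<psi> (x + y) = \<psi> x + \<psi> y"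
    and I: "I \<noteq> {}" "\<And>x y. x \<in> I \<Longrightarrow> x + y \<in> I"
    and B: "piecewise_syndetic_in UNIV {w. \<psi> w \<in> D}"
  shows "piecewise_syndetic_in (\<psi> ` I) (D \<inter> \<psi> ` I)"
proof -
  obtain G where G: "finite G" "G \<noteq> {}"
    and thick: "thick_in UNIV (\<Union>g\<in>G. neg_translate_in UNIV g {w. \<psi> w \<in> D})"
    using B by (auto simp: piecewise_syndetic_in_def)
  obtain z where z: "z \<in> I" using I(1) by blast
  define H where "H = (\<lambda>g. \<psi> (z + g)) ` G"
  have H: "H \<subseteq> \<psi> ` I" using z I(2) by (auto simp: H_def)
  have "thick_in (\<psi> ` I) (\<Union>h\<in>H. neg_translate_in (\<psi> ` I) h (D \<inter> \<psi> ` I))"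
    unfolding thick_in_def
  proof (intro conjI allI impI)
    show "(\<Union>h\<in>H. neg_translate_in (\<psi> ` I) h (D \<inter> \<psi> ` I)) \<subseteq> \<psi> ` I"
      by (auto simp: neg_translate_in_def)
    fix E assume E: "finite E \<and> E \<noteq> {} \<and> E \<subseteq> \<psi> ` I"
    then obtain E' where E': "finite E'" "E' \<noteq> {}" "E' \<subseteq> I" "E = \<psi> ` E'"
      by (metis finite_subset_image image_is_empty)
    have "\<exists>x\<in>UNIV. (\<lambda>e. e + x) ` ((\<lambda>e. z + z + e) ` E') \<subseteq>
        (\<Union>g\<in>G. neg_translate_in UNIV g {w. \<psi> w \<in> D})"
      using thick E' unfolding thick_in_def by blast
    then obtain x where x: "\<And>e. e \<in> E' \<Longrightarrow> \<exists>g\<in>G. \<psi> (g + (z + z + e + x)) \<in> D"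
      by (fastforce simp: neg_translate_in_def)
    have "\<psi> e + \<psi> (z + x) \<in> (\<Union>h\<in>H. neg_translate_in (\<psi> ` I) h (D \<inter> \<psi> ` I))" if e: "e \<in> E'" for e
    proof -
      obtain g where g: "g \<in> G" "\<psi> (g + (z + z + e + x)) \<in> D" using x[OF e] by blast
      have eq: "\<psi> (z + g) + (\<psi> e + \<psi> (z + x)) = \<psi> (g + (z + z + e + x))"
        by (simp add: \<psi>[symmetric] ac_simps)
      have "\<psi> (g + (z + z + e + x)) = \<psi> (z + (g + z + e + x))" by (simp add: ac_simps)
      then have "\<psi> (g + (z + z + e + x)) \<in> \<psi> ` I" using I(2)[OF z] by auto
      moreover have "\<psi> e + \<psi> (z + x) \<in> \<psi> ` I" using I(2) e E'(3) by (auto simp: \<psi>[symmetric])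
      ultimately have "\<psi> e + \<psi> (z + x) \<in> neg_translate_in (\<psi> ` I) (\<psi> (z + g)) (D \<inter> \<psi> ` I)"
        unfolding neg_translate_in_def mem_Collect_eq eq using g(2) by blast
      then show ?thesis using g(1) by (auto simp: H_def)
    qed
    then show "\<exists>x\<in>\<psi> ` I. (\<lambda>e. e + x) ` E \<subseteq>
        (\<Union>h\<in>H. neg_translate_in (\<psi> ` I) h (D \<inter> \<psi> ` I))"
      using I(2)[OF z] unfolding E'(4) by (intro bexI[of _ "\<psi> (z + x)"]) auto
  qed
  then show ?thesis
    unfolding piecewise_syndetic_in_def using H G by (auto simp: H_def intro!: exI[of _ H])
qed

section \<open>The semigroup of progressions as a homomorphic image\<close>

text \<open>
  The homomorphism \<open>(a, n) \<mapsto> a + n \<cdot> x\<close>, written as an iteration so that it has the value \<open>a\<close> at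
  \<open>n = 0\<close> in a semigroup without zero. This value provides the section \<open>a \<mapsto> (a, 0)\<close>.
\<close>

definition iterated_translate :: "'a::ab_semigroup_add \<Rightarrow> 'a \<times> nat \<Rightarrow> 'a" where
  "iterated_translate x w = (((+) x) ^^ snd w) (fst w)"

lemma iterated_translate_add:
  "iterated_translate x (v + w) = iterated_translate x v + iterated_translate x w"
proof -
  have shift: "((+) x ^^ n) (a + b) = a + ((+) x ^^ n) b" for n a b
    by (induction n) (auto simp: add.left_commute)
  have "((+) x ^^ (m + n)) (a + b) = ((+) x ^^ m) a + ((+) x ^^ n) b" for m n a b
    by (induction m) (auto simp: add.assoc shift)
  then show ?thesis by (simp add: iterated_translate_def)
qed

lemma iterated_translate_nfold_sum:
  assumes "n \<ge> 1"
  shows "iterated_translate x (a, n) = a + nfold_sum n x"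
proof -
  have "((+) x ^^ Suc k) a = a + ((+) x ^^ k) x" for k
    by (induction k) (simp_all add: add.commute add.left_commute)
  from this[of "n - 1"] show ?thesis
    using assms by (simp add: iterated_translate_def nfold_sum_def)
qed

lemma HC_eq_image:
  "HC s = (\<lambda>w. \<chi> i. iterated_translate (s $ i) w) ` {w. snd w \<ge> 1}" (is "_ = ?\<psi> ` ?I")
proof -
  have eq: "?\<psi> (a, n) = (\<chi> i. a + nfold_sum n (s $ i))" if "n \<ge> 1" for a n
    using that by (simp add: iterated_translate_nfold_sum)
  have "HC s = (\<lambda>(a, n). \<chi> i. a + nfold_sum n (s $ i)) ` ?I"
    unfolding HC_def by (auto simp: image_iff) blast
  also have "\<dots> = ?\<psi> ` ?I"
    by (rule image_cong) (auto simp: eq)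
  finally show ?thesis .
qed

theorem corollary10:
  fixes F :: "'a::ab_semigroup_add set"
    and s :: "('a, 'l::finite) vec"
  assumes "finite F" and "F \<noteq> {}" and "card F = CARD('l)"
    and "F = range (\<lambda>i. s $ i)"
  shows "subsemigroup (HC s) \<and>
    (\<forall>M :: 'a set. piecewise_syndetic_in UNIV M \<longrightarrow>
       piecewise_syndetic_in (HC s) (cart_power M \<inter> HC s))"
proof (intro conjI allI impI)
  define \<psi> where "\<psi> w = (\<chi> i. iterated_translate (s $ i) w)" for w
  define I :: "('a \<times> nat) set" where "I = {w. snd w \<ge> 1}"
  have HC: "HC s = \<psi> ` I" unfolding HC_eq_image \<psi>_def I_def ..
  have \<psi>: "\<psi> (v + w) = \<psi> v + \<psi> w" for v w
    by (simp add: \<psi>_def vec_eq_iff iterated_translate_add)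
  have ideal: "v + w \<in> I" if "v \<in> I" for v w using that by (simp add: I_def)
  have nonempty: "I \<noteq> {}" by (auto simp: I_def intro: exI[of _ "Suc 0"])
  show "subsemigroup (HC s)"
    unfolding subsemigroup_def HC using nonempty ideal by (auto simp: \<psi>[symmetric])
  fix M :: "'a set" assume M: "piecewise_syndetic_in UNIV M"
  have "piecewise_syndetic_in UNIV {w. \<forall>i. iterated_translate (s $ i) w \<in> M}"
  proof (rule piecewise_syndetic_simultaneous_preimage[where \<delta> = "\<lambda>a. (a, 0)", OF _ _ _ M])
    show "iterated_translate (s $ i) (a, 0) = a" for i a by (simp add: iterated_translate_def)
  qed (auto simp: iterated_translate_add)
  then have "piecewise_syndetic_in UNIV {w. \<psi> w \<in> cart_power M}"
    by (simp add: \<psi>_def cart_power_def)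
  with \<psi> nonempty ideal show "piecewise_syndetic_in (HC s) (cart_power M \<inter> HC s)"
    unfolding HC by (rule piecewise_syndetic_ideal_image)
qed

end
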